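(* Let $k\ge 2$. Every $k$-core is a $k$-shape and every $(k+1)$-core is a $k$-shape; that is, $\mathcal C^k\subset\Pi^k$ and $\mathcal C^{k+1}\subset\Pi^k$.
   Context: A partition $\lambda=(\lambda_1\ge\lambda_2\ge\cdots)$ is identified with its Ferrers diagram $\{(i,j)\in\mathbb Z_{>0}^2: j\le\lambda_i\}$ (the cell $(i,j)$ is in row $i$ and column $j$); $\lambda^t$ is the transpose. For $b=(i,j)\in\lambda$ the hook length is $h_\lambda(b)=(\lambda_i-j)+(\lambda^t_j-i)+1$. The $k$-boundary of $\lambda$ is $\partial^k\lambda=\{b\in\lambda: h_\lambda(b)\le k\}$; $\mathrm{rs}^k(\lambda)$ (resp. $\mathrm{cs}^k(\lambda)$) is the sequence whose $i$-th entry is the number of cells of $\partial^k\lambda$ in row $i$ (resp. column $i$). $\lambda$ is a $k$-shape if both $\mathrm{rs}^k(\lambda)$ and $\mathrm{cs}^k(\lambda)$ are partitions (weakly decreasing); $\Pi^k$ is the set of $k$-shapes. $\mathcal C^n$ is the set of $n$-cores, i.e. partitions with no cell of hook length $n$. *)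

theory Defs
  imports Main
begin

text \<open>
  A partition is a sequence \<open>p 1 \<ge> p 2 \<ge> \<dots>\<close> with finitely many nonzero entries. Rows and columns
  are numbered from 1; the unused entry \<open>p 0\<close> is fixed to be 0, so that partitions are equal as
  functions iff they are equal as sequences.
\<close>

definition is_partition :: "(nat \<Rightarrow> nat) \<Rightarrow> bool" where
  "is_partition p \<longleftrightarrow> p 0 = 0 \<and> (\<forall>i\<ge>1. p (i + 1) \<le> p i) \<and> finite {i. p i \<noteq> 0}"

definition diagram :: "(nat \<Rightarrow> nat) \<Rightarrow> (nat \<times> nat) set" where
  "diagram p = {(i, j). 1 \<le> i \<and> 1 \<le> j \<and> j \<le> p i}"

definition conjugate :: "(nat \<Rightarrow> nat) \<Rightarrow> nat \<Rightarrow> nat" where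
  "conjugate p j = card {i. (i, j) \<in> diagram p}"

text \<open>
  The hook length is only used for cells \<open>(i, j)\<close> of the diagram; there \<open>j \<le> p i\<close> and
  \<open>i \<le> conjugate p j\<close>, so neither subtraction is truncated.
\<close>

definition hook_length :: "(nat \<Rightarrow> nat) \<Rightarrow> nat \<times> nat \<Rightarrow> nat" where
  "hook_length p = (\<lambda>(i, j). (p i - j) + (conjugate p j - i) + 1)"

definition k_boundary :: "nat \<Rightarrow> (nat \<Rightarrow> nat) \<Rightarrow> (nat \<times> nat) set" where
  "k_boundary k p = {b \<in> diagram p. hook_length p b \<le> k}"

definition row_shape :: "nat \<Rightarrow> (nat \<Rightarrow> nat) \<Rightarrow> nat \<Rightarrow> nat" where
  "row_shape k p i = card {j. (i, j) \<in> k_boundary k p}"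

definition col_shape :: "nat \<Rightarrow> (nat \<Rightarrow> nat) \<Rightarrow> nat \<Rightarrow> nat" where
  "col_shape k p j = card {i. (i, j) \<in> k_boundary k p}"

definition k_shapes :: "nat \<Rightarrow> (nat \<Rightarrow> nat) set" where
  "k_shapes k = {p. is_partition p \<and> is_partition (row_shape k p) \<and> is_partition (col_shape k p)}"

definition n_cores :: "nat \<Rightarrow> (nat \<Rightarrow> nat) set" where
  "n_cores n = {p. is_partition p \<and> (\<forall>b\<in>diagram p. hook_length p b \<noteq> n)}"

end

theory Submission
  imports Defs
begin

text \<open>
  Let \<open>p\<close> be a core for \<open>n = k\<close> or \<open>n = k + 1\<close>. Shift row \<open>i + 1\<close> of the diagram to the right
  until its end lies below the end of row \<open>i\<close>, and send each cell \<open>(i + 1, j)\<close> to the cell of row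
  \<open>i\<close> directly above its shifted position. The arm is unchanged; the column may have become
  shorter, but the new cell is one row higher, so the leg grows by at most 1. Hence the hook length
  grows by at most 1. Since the hook length \<open>n\<close> never occurs, a hook length that is at most \<open>k\<close>
  cannot be pushed beyond \<open>k\<close>: if \<open>n = k\<close>, it was at most \<open>k - 1\<close> before, and if \<open>n = k + 1\<close>, the
  value \<open>k + 1\<close> is forbidden after. So the map injects the \<open>k\<close>-boundary cells of row \<open>i + 1\<close> into
  those of row \<open>i\<close> (lemma \<open>core_boundary_shift\<close>), which makes the row shape a partition.

  Conjugation preserves hook lengths and hence cores, and it exchanges the row shape with the
  column shape. So the statement on columns is the one on rows, applied to the conjugate partition.
\<close>

lemma partition_antimono:
  assumes "is_partition p" "1 \<le> i" "i \<le> i'"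
  shows "p i' \<le> p i"
  using assms(3)
proof (induction i' rule: dec_induct)
  case base
  show ?case by simp
next
  case (step m)
  then have "p (m + 1) \<le> p m"
    using assms by (simp add: is_partition_def)
  then show ?case
    using step.IH by simp
qed

text \<open>
  The Galois connection between a partition and its conjugate: a column is an initial segment of
  the rows, so the number of its cells is also the index of its last cell. All properties of the
  conjugate follow from this.
\<close>

lemma le_conjugate_iff:
  assumes p: "is_partition p" and "1 \<le> i" "1 \<le> j"
  shows "i \<le> conjugate p j \<longleftrightarrow> j \<le> p i"
proof -
  define A where "A = {i. (i, j) \<in> diagram p}"
  have A: "a \<in> A \<longleftrightarrow> 1 \<le> a \<and> j \<le> p a" for a
    using \<open>1 \<le> j\<close> by (simp add: A_def diagram_def)
  have "finite {i. p i \<noteq> 0}"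
    using p by (simp add: is_partition_def)
  then have fin: "finite A"
    by (rule rev_finite_subset) (use \<open>1 \<le> j\<close> in \<open>auto simp: A_def diagram_def\<close>)
  have card: "conjugate p j = card A"
    by (simp add: conjugate_def A_def)
  show ?thesis
  proof
    assume "j \<le> p i"
    then have "a \<in> A" if "1 \<le> a" "a \<le> i" for a
      using that partition_antimono[OF p, of a i] A[of a] by linarith
    then have "{1..i} \<subseteq> A"
      by auto
    then show "i \<le> conjugate p j"
      using card_mono[OF fin, of "{1..i}"] card by simp
  next
    assume le: "i \<le> conjugate p j"
    show "j \<le> p i"
    proof (rule ccontr)
      assume "\<not> j \<le> p i"
      then have "a < i" if "a \<in> A" for a
        using that partition_antimono[OF p \<open>1 \<le> i\<close>, of a] A[of a] by linarith
      then have "A \<subseteq> {1..<i}"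
        by (auto simp: A)
      then have "card A \<le> i - 1"
        using card_mono[of "{1..<i}" A] by simp
      then show False
        using le card \<open>1 \<le> i\<close> by simp
    qed
  qed
qed

lemma conjugate_zero: "conjugate p 0 = 0"
  by (simp add: conjugate_def diagram_def)

lemma is_partition_conjugate:
  assumes p: "is_partition p"
  shows "is_partition (conjugate p)"
  unfolding is_partition_def
proof (intro conjI allI impI)
  show "conjugate p 0 = 0"
    by (rule conjugate_zero)
next
  fix j :: nat
  assume j: "1 \<le> j"
  show "conjugate p (j + 1) \<le> conjugate p j"
  proof (cases "conjugate p (j + 1) = 0")
    case False
    then show ?thesis
      using le_conjugate_iff[OF p, of "conjugate p (j + 1)" "j + 1"]
        le_conjugate_iff[OF p, of "conjugate p (j + 1)" j] j
      by simp
  qed simp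
next
  have "j \<le> p 1" if "conjugate p j \<noteq> 0" for j
    using that le_conjugate_iff[OF p, of 1 j] conjugate_zero[of p] by (cases "j = 0") auto
  then have "{j. conjugate p j \<noteq> 0} \<subseteq> {..p 1}"
    by auto
  then show "finite {j. conjugate p j \<noteq> 0}"
    by (rule finite_subset) simp
qed

lemma mem_diagram_conjugate_iff:
  assumes "is_partition p"
  shows "(j, i) \<in> diagram (conjugate p) \<longleftrightarrow> (i, j) \<in> diagram p"
  using le_conjugate_iff[OF assms, of i j] by (auto simp: diagram_def)

lemma conjugate_conjugate:
  assumes p: "is_partition p"
  shows "conjugate (conjugate p) = p"
proof
  fix i
  have "p 0 = 0"
    using p by (simp add: is_partition_def)
  then have "{j. (j, i) \<in> diagram (conjugate p)} = {1..p i}"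
    unfolding mem_diagram_conjugate_iff[OF p] by (cases "i = 0") (auto simp: diagram_def)
  then show "conjugate (conjugate p) i = p i"
    by (simp add: conjugate_def[of "conjugate p"])
qed

lemma hook_length_conjugate:
  assumes "is_partition p"
  shows "hook_length (conjugate p) (j, i) = hook_length p (i, j)"
  by (simp add: hook_length_def conjugate_conjugate[OF assms])

lemma conjugate_core:
  assumes "p \<in> n_cores n"
  shows "conjugate p \<in> n_cores n"
  using assms is_partition_conjugate[of p]
  by (auto simp: n_cores_def mem_diagram_conjugate_iff hook_length_conjugate)

lemma row_shape_conjugate:
  assumes "is_partition p"
  shows "row_shape k (conjugate p) = col_shape k p"
  by (simp add: fun_eq_iff row_shape_def col_shape_def k_boundary_def
      mem_diagram_conjugate_iff[OF assms] hook_length_conjugate[OF assms])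

text \<open>
  The distance \<open>p i - p (i + 1)\<close> aligns the right ends of the two rows, so that the arm is
  preserved. The bound on the leg holds because columns further to the right are not longer.
\<close>

lemma hook_length_shift:
  assumes p: "is_partition p" and b: "(i + 1, j) \<in> diagram p" and i: "1 \<le> i"
  shows "(i, j + (p i - p (i + 1))) \<in> diagram p"
    and "hook_length p (i, j + (p i - p (i + 1))) \<le> hook_length p (i + 1, j) + 1"
proof -
  have j: "1 \<le> j" "j \<le> p (i + 1)"
    using b by (auto simp: diagram_def)
  have le: "p (i + 1) \<le> p i"
    using p i by (simp add: is_partition_def)
  show "(i, j + (p i - p (i + 1))) \<in> diagram p"
    using i j le unfolding diagram_def by auto
  have "conjugate p (j + (p i - p (i + 1))) \<le> conjugate p j"
    using partition_antimono[OF is_partition_conjugate[OF p] \<open>1 \<le> j\<close>] by simp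
  moreover have "i + 1 \<le> conjugate p j"
    using le_conjugate_iff[OF p, of "i + 1" j] j by simp
  ultimately show "hook_length p (i, j + (p i - p (i + 1))) \<le> hook_length p (i + 1, j) + 1"
    using j le by (simp add: hook_length_def)
qed

lemma core_boundary_shift:
  assumes core: "p \<in> n_cores n" and n: "n = k \<or> n = k + 1"
    and i: "1 \<le> i" and b: "(i + 1, j) \<in> k_boundary k p"
  shows "(i, j + (p i - p (i + 1))) \<in> k_boundary k p"
proof -
  have p: "is_partition p"
    using core by (simp add: n_cores_def)
  have b': "(i + 1, j) \<in> diagram p" "hook_length p (i + 1, j) \<le> k"
    using b by (simp_all add: k_boundary_def)
  note shift = hook_length_shift[OF p b'(1) i]
  have "hook_length p (i + 1, j) \<noteq> n" "hook_length p (i, j + (p i - p (i + 1))) \<noteq> n"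
    using core b'(1) shift(1) by (auto simp: n_cores_def)
  then have "hook_length p (i, j + (p i - p (i + 1))) \<le> k"
    using n b'(2) shift(2) by linarith
  then show ?thesis
    using shift(1) by (simp add: k_boundary_def)
qed

lemma is_partition_row_shape_core:
  assumes core: "p \<in> n_cores n" and n: "n = k \<or> n = k + 1"
  shows "is_partition (row_shape k p)"
  unfolding is_partition_def
proof (intro conjI allI impI)
  have sub: "{j. (i, j) \<in> k_boundary k p} \<subseteq> {1..p i}" for i
    by (auto simp: k_boundary_def diagram_def)
  show "row_shape k p 0 = 0"
    by (simp add: row_shape_def k_boundary_def diagram_def)
  show "row_shape k p (i + 1) \<le> row_shape k p i" if i: "1 \<le> i" for i
    unfolding row_shape_def
  proof (rule card_inj_on_le)
    show "inj_on (\<lambda>j. j + (p i - p (i + 1))) {j. (i + 1, j) \<in> k_boundary k p}"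
      by (simp add: inj_on_def)
    show "(\<lambda>j. j + (p i - p (i + 1))) ` {j. (i + 1, j) \<in> k_boundary k p}
        \<subseteq> {j. (i, j) \<in> k_boundary k p}"
      using core_boundary_shift[OF core n i] by blast
    show "finite {j. (i, j) \<in> k_boundary k p}"
      using sub by (rule finite_subset) simp
  qed
  have "p i \<noteq> 0" if "row_shape k p i \<noteq> 0" for i
  proof
    assume "p i = 0"
    then have "{j. (i, j) \<in> k_boundary k p} = {}"
      using sub[of i] by simp
    then show False
      using that by (simp add: row_shape_def)
  qed
  moreover have "finite {i. p i \<noteq> 0}"
    using core by (simp add: n_cores_def is_partition_def)
  ultimately show "finite {i. row_shape k p i \<noteq> 0}"
    by (auto elim: rev_finite_subset)
qed

lemma core_is_k_shape:
  assumes core: "p \<in> n_cores n" and n: "n = k \<or> n = k + 1"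
  shows "p \<in> k_shapes k"
proof -
  have p: "is_partition p"
    using core by (simp add: n_cores_def)
  have "is_partition (col_shape k p)"
    using is_partition_row_shape_core[OF conjugate_core[OF core] n]
    by (simp add: row_shape_conjugate[OF p])
  then show ?thesis
    using p is_partition_row_shape_core[OF core n] by (simp add: k_shapes_def)
qed

theorem proposition10:
  fixes k :: nat
  assumes "k \<ge> 2"
  shows "n_cores k \<subseteq> k_shapes k \<and> n_cores (k + 1) \<subseteq> k_shapes k"
  using core_is_k_shape by blast

end
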